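(* Let $k\ge 1$ be an integer, and let $p$ be a symmetric polynomial ($p^*=p$) in the free $*$-algebra $\mathbb R\langle x\rangle$ (symmetric variables) or in the free $*$-algebra $\mathbb R\langle x,x^*\rangle$ (free variables). If the $k$-th directional derivative $p^{(k)}(x)[h]$ is a matrix positive polynomial, then $p$ has degree $k$ or less.
   Context: $\mathbb R\langle x\rangle$ denotes the algebra of polynomials with real coefficients in non-commuting variables $x=(x_1,\dots,x_g)$, with the involution ${}^*$ which is $\mathbb R$-linear, reverses products, $(fp)^*=p^*f^*$, and satisfies $x_j^*=x_j$. $\mathbb R\langle x,x^*\rangle$ denotes the algebra of polynomials with real coefficients in $2g$ non-commuting variables $x_1,\dots,x_g,x_1^*,\dots,x_g^*$, with the $\mathbb R$-linear product-reversing involution exchanging $x_j$ and $x_j^*$. The degree is the usual total degree (maximal length of a word occurring with nonzero coefficient). The $k$-th directional derivative of $p$ is $$p^{(k)}(x)[h]=\frac{d^k}{dt^k}\,p(x+th)\Big|_{t=0},$$ a polynomial in the free $*$-algebra in the variables $x_1,\dots,x_g$ and $h_1,\dots,h_g$, homogeneous of degree $k$ in $h$. In the case of symmetric variables, the $h_j$ are also symmetric, $h_j^*=h_j$. In the case of free variables, the algebra also contains $x_j^*$ and $h_j^*$, and $x_j^*$ is replaced by $x_j^*+th_j^*$ in forming $p(x+th)$. The polynomial $p^{(k)}(x)[h]$ is matrix positive if for every $n\ge 1$ and all $g$-tuples $X=(X_1,\dots,X_g)$, $H=(H_1,\dots,H_g)$ of real $n\times n$ matrices (symmetric matrices in the case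 of $\mathbb R\langle x\rangle$; arbitrary matrices, with $x_j^*,h_j^*$ evaluated at the transposes $X_j^T,H_j^T$, in the case of $\mathbb R\langle x,x^*\rangle$), the matrix $p^{(k)}(X)[H]$ is positive semi-definite. *)

theory Defs
  imports
    "HOL-Analysis.Analysis"
    "HOL-Library.Poly_Mapping"
    "Jordan_Normal_Form.Matrix"
begin

section \<open>Words and polynomials in non-commuting variables\<close>

text \<open>
  The free monoid of words over the alphabet 'a. Concatenation is written additively because
  the convolution product of finitely supported functions is only available for
  additive monoids of exponents.
\<close>

datatype 'a nc_word = NCWord (letters: "'a list")

instantiation nc_word :: (type) monoid_add
begin

definition zero_nc_word :: "'a nc_word" where
  "zero_nc_word = NCWord []"

definition plus_nc_word :: "'a nc_word \<Rightarrow> 'a nc_word \<Rightarrow> 'a nc_word" where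
  "plus_nc_word u v = NCWord (letters u @ letters v)"

instance
  by standard (simp_all add: zero_nc_word_def plus_nc_word_def)

end

text \<open>
  The monoid algebra of words, with its library ring structure: real polynomials in
  non-commuting letters from 'a.
\<close>

type_synonym 'a nc_poly = "'a nc_word \<Rightarrow>\<^sub>0 real"

definition nc_const :: "real \<Rightarrow> 'a nc_poly" where
  "nc_const c = Poly_Mapping.single 0 c"

definition nc_letter :: "'a \<Rightarrow> 'a nc_poly" where
  "nc_letter a = Poly_Mapping.single (NCWord [a]) 1"

text \<open>The zero polynomial gets degree 0.\<close>

definition nc_degree :: "'a nc_poly \<Rightarrow> nat" where
  "nc_degree p = Max (insert 0 ((\<lambda>w. length (letters w)) ` Poly_Mapping.keys p))"

text \<open>The algebra homomorphism sending each letter a to f a.\<close>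

definition nc_subst :: "('a \<Rightarrow> 'b nc_poly) \<Rightarrow> 'a nc_poly \<Rightarrow> 'b nc_poly" where
  "nc_subst f p =
     (\<Sum>w\<in>Poly_Mapping.keys p.
        nc_const (Poly_Mapping.lookup p w) * prod_list (map f (letters w)))"

text \<open>The linear, product-reversing extension of the map s on letters.\<close>

definition nc_star :: "('a \<Rightarrow> 'a) \<Rightarrow> 'a nc_poly \<Rightarrow> 'a nc_poly" where
  "nc_star s p =
     (\<Sum>w\<in>Poly_Mapping.keys p.
        Poly_Mapping.single (NCWord (rev (map s (letters w)))) (Poly_Mapping.lookup p w))"

text \<open>Evaluation at n by n matrices; the empty word is evaluated to the identity matrix.\<close>

definition nc_eval :: "nat \<Rightarrow> ('a \<Rightarrow> real mat) \<Rightarrow> 'a nc_poly \<Rightarrow> real mat" where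
  "nc_eval n A p =
     mat n n (\<lambda>(i, j).
       \<Sum>w\<in>Poly_Mapping.keys p.
         Poly_Mapping.lookup p w * (foldr (\<lambda>a M. A a * M) (letters w) (1\<^sub>m n) $$ (i, j)))"

definition psd_mat :: "nat \<Rightarrow> real mat \<Rightarrow> bool" where
  "psd_mat n A \<longleftrightarrow>
     A \<in> carrier_mat n n \<and> transpose_mat A = A \<and>
     (\<forall>v\<in>carrier_vec n. 0 \<le> scalar_prod v (A *\<^sub>v v))"

text \<open>
  The k-th derivative at 0 of a curve of polynomials, taken coefficient by coefficient. The
  curves p(x + th) used below have all their words in a finite set independent of t, so that the
  coefficients of the derivative are finitely supported (see the lookup lemmas below).
\<close>

definition nc_deriv0 :: "nat \<Rightarrow> (real \<Rightarrow> 'a nc_poly) \<Rightarrow> 'a nc_poly" where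
  "nc_deriv0 k q =
     Abs_poly_mapping (\<lambda>w. (deriv ^^ k) (\<lambda>t. Poly_Mapping.lookup (q t) w) 0)"

section \<open>Symmetric variables\<close>

text \<open>
  The algebra in symmetric variables indexed by 'g is \<^typ>\<open>'g nc_poly\<close>. In \<^typ>\<open>('g + 'g) nc_poly\<close>
  the letter \<^term>\<open>Inl j\<close> is the variable x_j and \<^term>\<open>Inr j\<close> is h_j.
\<close>

definition sym_star :: "'g nc_poly \<Rightarrow> 'g nc_poly" where
  "sym_star = nc_star (\<lambda>j. j)"

definition sym_shift :: "real \<Rightarrow> 'g nc_poly \<Rightarrow> ('g + 'g) nc_poly" where
  "sym_shift t = nc_subst (\<lambda>j. nc_letter (Inl j) + nc_const t * nc_letter (Inr j))"

definition sym_dirderiv :: "nat \<Rightarrow> 'g nc_poly \<Rightarrow> ('g + 'g) nc_poly" where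
  "sym_dirderiv k p = nc_deriv0 k (\<lambda>t. sym_shift t p)"

definition sym_matrix_positive :: "('g + 'g) nc_poly \<Rightarrow> bool" where
  "sym_matrix_positive q \<longleftrightarrow>
     (\<forall>n\<ge>1. \<forall>X H.
        (\<forall>j. X j \<in> carrier_mat n n \<and> transpose_mat (X j) = X j) \<and>
        (\<forall>j. H j \<in> carrier_mat n n \<and> transpose_mat (H j) = H j) \<longrightarrow>
        psd_mat n (nc_eval n (case_sum X H) q))"

section \<open>Free variables\<close>

text \<open>\<^term>\<open>Var j\<close> is the variable x_j and \<^term>\<open>Adj j\<close> is its formal adjoint.\<close>

datatype 'v letter = Var 'v | Adj 'v

primrec letter_adj :: "'v letter \<Rightarrow> 'v letter" where
  "letter_adj (Var v) = Adj v"
| "letter_adj (Adj v) = Var v"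

definition free_star :: "'v letter nc_poly \<Rightarrow> 'v letter nc_poly" where
  "free_star = nc_star letter_adj"

text \<open>
  Again \<^term>\<open>Inl j\<close> indexes x_j and \<^term>\<open>Inr j\<close> indexes h_j; the mapped letters keep their
  adjoint mark, so the adjoint of x_j is replaced by the adjoint of x_j plus t times that of h_j.
\<close>

definition free_shift :: "real \<Rightarrow> 'g letter nc_poly \<Rightarrow> ('g + 'g) letter nc_poly" where
  "free_shift t =
     nc_subst (\<lambda>l. nc_letter (map_letter Inl l) + nc_const t * nc_letter (map_letter Inr l))"

definition free_dirderiv :: "nat \<Rightarrow> 'g letter nc_poly \<Rightarrow> ('g + 'g) letter nc_poly" where
  "free_dirderiv k p = nc_deriv0 k (\<lambda>t. free_shift t p)"

definition letter_value :: "('v \<Rightarrow> real mat) \<Rightarrow> 'v letter \<Rightarrow> real mat" where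
  "letter_value A l = (case l of Var v \<Rightarrow> A v | Adj v \<Rightarrow> transpose_mat (A v))"

definition free_matrix_positive :: "('g + 'g) letter nc_poly \<Rightarrow> bool" where
  "free_matrix_positive q \<longleftrightarrow>
     (\<forall>n\<ge>1. \<forall>X H.
        (\<forall>j. X j \<in> carrier_mat n n) \<and> (\<forall>j. H j \<in> carrier_mat n n) \<longrightarrow>
        psd_mat n (nc_eval n (letter_value (case_sum X H)) q))"

section \<open>The coefficientwise derivatives are polynomials\<close>

lemma keys_shift_prod:
  fixes f g :: "'a \<Rightarrow> 'b"
  assumes "w \<in> Poly_Mapping.keys
             (prod_list (map (\<lambda>a. nc_letter (f a) + nc_const t * nc_letter (g a)) us))"
  shows "letters w \<in> {vs. set vs \<subseteq> f ` set us \<union> g ` set us \<and> length vs = length us}"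
  using assms
proof (induction us arbitrary: w)
  case Nil
  then show ?case
    by (simp add: zero_nc_word_def split: if_splits flip: single_one)
next
  case (Cons a us)
  let ?F = "\<lambda>a. nc_letter (f a) + nc_const t * nc_letter (g a) :: 'b nc_poly"
  from Cons.prems have "w \<in> Poly_Mapping.keys (?F a * prod_list (map ?F us))"
    by simp
  then obtain u v where uv: "w = u + v" "u \<in> Poly_Mapping.keys (?F a)"
      "v \<in> Poly_Mapping.keys (prod_list (map ?F us))"
    using keys_mult[of "?F a" "prod_list (map ?F us)"] by blast
  have "Poly_Mapping.keys (?F a) \<subseteq>
      Poly_Mapping.keys (nc_letter (f a) :: 'b nc_poly) \<union>
      Poly_Mapping.keys (nc_const t * nc_letter (g a) :: 'b nc_poly)"
    by (rule keys_add)
  then have "Poly_Mapping.keys (?F a) \<subseteq> {NCWord [f a], NCWord [g a]}"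
    by (auto simp: nc_letter_def nc_const_def mult_single zero_nc_word_def plus_nc_word_def
        split: if_splits)
  with uv Cons.IH[OF uv(3)] show ?case
    by (auto simp: plus_nc_word_def)
qed

lemma lookup_nc_deriv0:
  fixes q :: "real \<Rightarrow> 'a nc_poly"
  assumes "finite S" and S: "\<And>t. Poly_Mapping.keys (q t) \<subseteq> S"
  shows "Poly_Mapping.lookup (nc_deriv0 k q) w
           = (deriv ^^ k) (\<lambda>t. Poly_Mapping.lookup (q t) w) 0"
proof -
  have deriv_zero: "(deriv ^^ k) (\<lambda>t::real. 0::real) = (\<lambda>t. 0)"
    by (induction k) simp_all
  have "(deriv ^^ k) (\<lambda>t. Poly_Mapping.lookup (q t) w) 0 = 0" if "w \<notin> S" for w
  proof -
    have "Poly_Mapping.lookup (q t) w = 0" for t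
      using S[of t] that by (auto simp: in_keys_iff)
    then show ?thesis by (simp add: deriv_zero)
  qed
  then have "finite {w. (deriv ^^ k) (\<lambda>t. Poly_Mapping.lookup (q t) w) 0 \<noteq> 0}"
    by (intro finite_subset[OF _ assms(1)]) blast
  then show ?thesis
    by (simp add: nc_deriv0_def Abs_poly_mapping_inverse)
qed

lemma lookup_nc_deriv0_subst:
  fixes p :: "'a nc_poly" and f g :: "'a \<Rightarrow> 'b"
  defines "q \<equiv> \<lambda>t. nc_subst (\<lambda>a. nc_letter (f a) + nc_const t * nc_letter (g a)) p"
  shows "Poly_Mapping.lookup (nc_deriv0 k q) w
           = (deriv ^^ k) (\<lambda>t. Poly_Mapping.lookup (q t) w) 0"
proof -
  define W where
    "W u = {vs. set vs \<subseteq> f ` set (letters u) \<union> g ` set (letters u)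
              \<and> length vs = length (letters u)}" for u
  define S where "S = NCWord ` (\<Union>u\<in>Poly_Mapping.keys p. W u)"
  have "finite (W u)" for u
    unfolding W_def by (rule finite_lists_length_eq) simp
  then have "finite S"
    unfolding S_def by simp
  have "Poly_Mapping.keys (q t) \<subseteq> S" for t
  proof
    define P :: "'a nc_word \<Rightarrow> 'b nc_poly" where
      "P u = prod_list (map (\<lambda>a. nc_letter (f a) + nc_const t * nc_letter (g a)) (letters u))"
      for u
    have q_sum: "q t = (\<Sum>u\<in>Poly_Mapping.keys p. nc_const (Poly_Mapping.lookup p u) * P u)"
      unfolding q_def nc_subst_def P_def ..
    fix w assume "w \<in> Poly_Mapping.keys (q t)"
    then have "w \<in> (\<Union>u\<in>Poly_Mapping.keys p.
        Poly_Mapping.keys (nc_const (Poly_Mapping.lookup p u) * P u))"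
      unfolding q_sum by (rule subsetD[OF keys_sum])
    then obtain u where u: "u \<in> Poly_Mapping.keys p"
        "w \<in> Poly_Mapping.keys (nc_const (Poly_Mapping.lookup p u) * P u)"
      by (elim UN_E)
    have "w \<in> {c + v | c v. c \<in> Poly_Mapping.keys (nc_const (Poly_Mapping.lookup p u) :: 'b nc_poly)
        \<and> v \<in> Poly_Mapping.keys (P u)}"
      by (rule subsetD[OF keys_mult u(2)])
    then have "w \<in> Poly_Mapping.keys (P u)"
      by (auto simp: nc_const_def split: if_splits)
    then have "letters w \<in> W u"
      unfolding P_def W_def by (rule keys_shift_prod)
    then have "NCWord (letters w) \<in> S"
      unfolding S_def using u(1) by (intro imageI UN_I)
    then show "w \<in> S" by simp
  qed
  with \<open>finite S\<close> show ?thesis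
    by (rule lookup_nc_deriv0)
qed

lemma lookup_sym_dirderiv:
  "Poly_Mapping.lookup (sym_dirderiv k p) w
     = (deriv ^^ k) (\<lambda>t. Poly_Mapping.lookup (sym_shift t p) w) 0"
  unfolding sym_dirderiv_def sym_shift_def by (rule lookup_nc_deriv0_subst)

lemma lookup_free_dirderiv:
  "Poly_Mapping.lookup (free_dirderiv k p) w
     = (deriv ^^ k) (\<lambda>t. Poly_Mapping.lookup (free_shift t p) w) 0"
  unfolding free_dirderiv_def free_shift_def by (rule lookup_nc_deriv0_subst)

end

theory Submission
  imports Defs
begin

text \<open>
  Let \<open>p\<close> have degree \<open>d > k\<close> and let \<open>a\<close> be a word of length \<open>d\<close> in \<open>p\<close>. Evaluate the derivative on
  the path with vertices \<open>0, \<dots>, d\<close>: the \<open>i\<close>-th edge carries the \<open>i\<close>-th letter of \<open>a\<close>, taken as a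
  direction \<open>h\<close> for the first \<open>k\<close> edges and as a variable \<open>x\<close> for the others, and each letter acts
  as the (partial) adjacency matrix of its edges. The only walk of length at most \<open>d\<close> from \<open>0\<close>
  to \<open>d\<close> goes straight along the path, so the \<open>(0, d)\<close> entry of the value is \<open>k!\<close> times the
  coefficient of \<open>a\<close>. A closed walk at \<open>d\<close> that uses an \<open>h\<close>-edge takes at least \<open>2 (d - k)\<close>
  steps on \<open>x\<close>-edges; with \<open>k\<close> steps on \<open>h\<close>-edges its length exceeds \<open>d\<close>, so the \<open>(d, d)\<close> entry
  vanishes. Positive semi-definiteness then makes the \<open>(0, d)\<close> entry vanish, a contradiction.
\<close>

section \<open>Semi-definite matrices, derivatives of monomials, degree\<close>

text \<open>As the \<open>(j, j)\<close> entry is zero, the quadratic form at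
  \<open>e_i + c e_j\<close> is affine in \<open>c\<close> with slope twice the
  \<open>(i, j)\<close> entry, hence negative for some \<open>c\<close> unless that entry
  vanishes.\<close>

lemma psd_mat_zero_diag:
  assumes psd: "psd_mat n M" and ij: "i < n" "j < n" and zero: "M $$ (j, j) = 0"
  shows "M $$ (i, j) = 0"
proof (rule ccontr)
  assume nz: "M $$ (i, j) \<noteq> 0"
  then have ne: "i \<noteq> j" using zero by auto
  have M: "M \<in> carrier_mat n n" "transpose_mat M = M"
    using psd by (auto simp: psd_mat_def)
  have sym: "M $$ (j, i) = M $$ (i, j)"
    using M ij by (metis carrier_matD index_transpose_mat(1))
  \<comment> \<open>Solves \<open>M $$ (i, i) + 2 * c * M $$ (i, j) = - 1\<close>.\<close>
  define c where "c = - (M $$ (i, i) + 1) / (2 * M $$ (i, j))"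
  define v where "v = vec n (\<lambda>x. (if x = i then 1 else 0) + (if x = j then c else 0))"
  have v: "v \<in> carrier_vec n" by (simp add: v_def)
  have Mv: "(M *\<^sub>v v) $ x = M $$ (x, i) + M $$ (x, j) * c" if "x < n" for x
  proof -
    have "(M *\<^sub>v v) $ x = (\<Sum>y<n. M $$ (x, y)
        * ((if y = i then 1 else 0) + (if y = j then c else 0)))"
      using M that ne by (auto simp: scalar_prod_def v_def lessThan_atLeast0 intro!: sum.cong)
    also have "\<dots> = (\<Sum>y<n. (if y = i then M $$ (x, y) else 0)
        + (if y = j then M $$ (x, y) * c else 0))"
      using ne by (intro sum.cong) auto
    finally show ?thesis using ij by (simp add: sum.distrib)
  qed
  have "scalar_prod v (M *\<^sub>v v)
      = (\<Sum>x<n. ((if x = i then 1 else 0) + (if x = j then c else 0))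
                    * (M $$ (x, i) + M $$ (x, j) * c))"
    using M Mv by (auto simp: scalar_prod_def v_def lessThan_atLeast0 intro!: sum.cong)
  also have "\<dots> = (\<Sum>x<n. (if x = i then M $$ (x, i) + M $$ (x, j) * c else 0)
       + (if x = j then c * (M $$ (x, i) + M $$ (x, j) * c) else 0))"
    using ne by (intro sum.cong) auto
  also have "\<dots> = M $$ (i, i) + 2 * c * M $$ (i, j)"
    using ij by (simp add: sum.distrib sym zero)
  also have "\<dots> = - 1"
    using nz by (simp add: c_def field_simps)
  finally show False
    using psd v unfolding psd_mat_def by force
qed

text \<open>Stated for every \<open>t\<close> so that the induction can differentiate again; at 0
  only \<open>m = k\<close> survives, with value \<open>c * fact k\<close>.\<close>

lemma higher_deriv_monomial:
  fixes c :: real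
  shows "(deriv ^^ k) (\<lambda>t. c * t ^ m)
           = (\<lambda>t. if k \<le> m then c * (fact m / fact (m - k)) * t ^ (m - k) else 0)"
proof (induction k)
  case 0
  then show ?case by simp
next
  case (Suc k)
  show ?case
  proof (cases "Suc k \<le> m")
    case True
    then obtain r where r: "m - k = Suc r" "m - Suc k = r"
      by (metis Suc_diff_Suc Suc_le_lessD)
    have "deriv (\<lambda>t. c * (fact m / fact (m - k)) * t ^ (m - k)) t
            = c * (fact m / fact (m - Suc k)) * t ^ (m - Suc k)" for t
    proof -
      have "deriv (\<lambda>t. c * (fact m / fact (Suc r)) * t ^ Suc r) t
          = c * (fact m / fact (Suc r)) * (real (Suc r) * t ^ (Suc r - Suc 0))"
        by (intro DERIV_imp_deriv DERIV_cmult DERIV_pow)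
      also have "\<dots> = c * (fact m / fact r) * t ^ r"
        by (simp add: fact_Suc field_simps del: of_nat_Suc)
      finally show ?thesis by (simp only: r)
    qed
    with True show ?thesis by (simp add: Suc.IH)
  next
    case False
    then have "(deriv ^^ k) (\<lambda>t. c * t ^ m) = (\<lambda>t. if k = m then c * fact m else 0)"
      unfolding Suc.IH by (auto simp: fun_eq_iff)
    with False show ?thesis by simp
  qed
qed

lemma lookup_sum_single:
  assumes "finite S"
  shows "Poly_Mapping.lookup (\<Sum>vs\<in>S. Poly_Mapping.single (NCWord vs) (c vs)) w
           = (if letters w \<in> S then c (letters w) else (0 :: real))"
proof -
  have "Poly_Mapping.lookup (\<Sum>vs\<in>S. Poly_Mapping.single (NCWord vs) (c vs)) w
      = (\<Sum>vs\<in>S. if vs = letters w then c vs else 0)"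
    unfolding lookup_sum
    by (rule sum.cong) (auto simp: lookup_single when_def)
  then show ?thesis using assms by simp
qed

lemma length_le_nc_degree:
  "w \<in> Poly_Mapping.keys p \<Longrightarrow> length (letters w) \<le> nc_degree p"
  unfolding nc_degree_def by (rule Max_ge) auto

lemma nc_degree_attained:
  assumes "nc_degree p > 0"
  obtains w where "w \<in> Poly_Mapping.keys p" "length (letters w) = nc_degree p"
proof -
  have "nc_degree p \<in> insert 0 ((\<lambda>w. length (letters w)) ` Poly_Mapping.keys p)"
    unfolding nc_degree_def by (rule Max_in) auto
  with assms that show thesis by auto
qed

section \<open>Coefficients of the directional derivative\<close>

text \<open>
  Both kinds of variables are treated at once: \<open>f\<close> and \<open>g\<close> send a letter to the corresponding
  letter of type \<open>x\<close> and \<open>h\<close>, \<open>base\<close> forgets the type, and \<open>dir\<close> recognizes the letters of type \<open>h\<close>.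
\<close>

locale shift_letters =
  fixes f g :: "'a \<Rightarrow> 'b" and base :: "'b \<Rightarrow> 'a" and dir :: "'b \<Rightarrow> bool"
  assumes base [simp]: "base (f a) = a" "base (g a) = a"
    and dir [simp]: "\<not> dir (f a)" "dir (g a)"
    and exhaust: "b = f (base b) \<or> b = g (base b)"
begin

definition dcount :: "'b list \<Rightarrow> nat" where
  "dcount vs = length (filter dir vs)"

lemma base_vimage_Cons:
  "{vs. map base vs = a # us}
     = Cons (f a) ` {vs. map base vs = us} \<union> Cons (g a) ` {vs. map base vs = us}"
proof (rule Set.set_eqI)
  fix vs
  show "vs \<in> {vs. map base vs = a # us} \<longleftrightarrow>
      vs \<in> Cons (f a) ` {vs. map base vs = us} \<union> Cons (g a) ` {vs. map base vs = us}"
  proof (cases vs)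
    case (Cons b bs)
    have "base b = a \<longleftrightarrow> b = f a \<or> b = g a"
      using exhaust[of b] base[of a] by metis
    with Cons show ?thesis by auto
  qed auto
qed

lemma finite_base_vimage: "finite {vs. map base vs = us}"
proof (induction us)
  case (Cons a us)
  then show ?case unfolding base_vimage_Cons by (intro finite_UnI finite_imageI)
qed simp

text \<open>Expanding means choosing the \<open>f\<close> or the \<open>g\<close> letter in each
  factor; every \<open>g\<close> brings one factor \<open>t\<close>.\<close>

lemma shift_prod:
  "prod_list (map (\<lambda>a. nc_letter (f a) + nc_const t * nc_letter (g a)) us)
     = (\<Sum>vs | map base vs = us. Poly_Mapping.single (NCWord vs) (t ^ dcount vs))"
proof (induction us)
  case Nil
  then show ?case
    by (simp add: dcount_def flip: zero_nc_word_def)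
next
  case (Cons a us)
  let ?S = "{vs. map base vs = us}"
  let ?m = "\<lambda>vs. Poly_Mapping.single (NCWord vs) (t ^ dcount vs)"
  have ne: "f a \<noteq> g a" using dir by metis
  have "(\<Sum>vs | map base vs = a # us. ?m vs)
      = (\<Sum>vs\<in>Cons (f a) ` ?S. ?m vs) + (\<Sum>vs\<in>Cons (g a) ` ?S. ?m vs)"
    unfolding base_vimage_Cons
    by (rule sum.union_disjoint) (use ne finite_base_vimage in auto)
  also have "\<dots> = (\<Sum>vs\<in>?S. ?m (f a # vs)) + (\<Sum>vs\<in>?S. ?m (g a # vs))"
    by (simp add: sum.reindex)
  also have "\<dots> = (nc_letter (f a) + nc_const t * nc_letter (g a)) * (\<Sum>vs\<in>?S. ?m vs)"
    by (simp add: distrib_right sum_distrib_left sum.distrib nc_letter_def nc_const_def mult_single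
        plus_nc_word_def zero_nc_word_def dcount_def)
  finally show ?case by (simp add: Cons.IH)
qed

text \<open>Only the word \<open>map base (letters w)\<close> of \<open>p\<close> can produce
  \<open>w\<close>, so coefficients never mix and each is a monomial in \<open>t\<close>.\<close>

lemma lookup_shift:
  "Poly_Mapping.lookup (nc_subst (\<lambda>a. nc_letter (f a) + nc_const t * nc_letter (g a)) p) w
     = Poly_Mapping.lookup p (NCWord (map base (letters w))) * t ^ dcount (letters w)"
proof -
  have const: "nc_const c * (\<Sum>vs | map base vs = us. Poly_Mapping.single (NCWord vs) (t ^ dcount vs))
      = (\<Sum>vs | map base vs = us. Poly_Mapping.single (NCWord vs) (c * t ^ dcount vs))" for c us
    by (simp add: sum_distrib_left nc_const_def mult_single)
  have "Poly_Mapping.lookup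
        (nc_subst (\<lambda>a. nc_letter (f a) + nc_const t * nc_letter (g a)) p) w
      = (\<Sum>u\<in>Poly_Mapping.keys p. if map base (letters w) = letters u
            then Poly_Mapping.lookup p u * t ^ dcount (letters w) else 0)"
    unfolding nc_subst_def lookup_sum
    by (simp add: shift_prod const lookup_sum_single finite_base_vimage)
  also have "\<dots> = (\<Sum>u\<in>Poly_Mapping.keys p. if u = NCWord (map base (letters w))
            then Poly_Mapping.lookup p u * t ^ dcount (letters w) else 0)"
    by (rule sum.cong) auto
  finally show ?thesis by (simp add: in_keys_iff)
qed

lemma lookup_deriv_shift:
  "Poly_Mapping.lookup
       (nc_deriv0 k (\<lambda>t. nc_subst (\<lambda>a. nc_letter (f a) + nc_const t * nc_letter (g a)) p)) w
     = (if dcount (letters w) = k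
        then fact k * Poly_Mapping.lookup p (NCWord (map base (letters w))) else 0)"
  unfolding lookup_nc_deriv0_subst lookup_shift higher_deriv_monomial
  by auto

end

section \<open>Evaluation along a path\<close>

text \<open>
  The transpose of the matrix of the letter \<open>b\<close> is that of \<open>adj b\<close>: an edge is traversed backwards
  by the adjoint of its letter.
\<close>

definition path_mat :: "'b list \<Rightarrow> ('b \<Rightarrow> 'b) \<Rightarrow> 'b \<Rightarrow> real mat" where
  "path_mat u adj b = mat (Suc (length u)) (Suc (length u))
     (\<lambda>(i, j). if j = Suc i \<and> u ! i = b \<or> i = Suc j \<and> u ! j = adj b then 1 else 0)"

lemma path_mat_carrier: "path_mat u adj b \<in> carrier_mat (Suc (length u)) (Suc (length u))"
  by (simp add: path_mat_def)

context
  fixes u :: "'b list" and adj :: "'b \<Rightarrow> 'b"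
begin

text \<open>Entry \<open>(i, j)\<close> counts the walks from \<open>i\<close> to \<open>j\<close>
  that read the letters of \<open>w\<close> in order.\<close>

definition word_mat :: "'b list \<Rightarrow> real mat" where
  "word_mat w = foldr (\<lambda>a M. path_mat u adj a * M) w (1\<^sub>m (Suc (length u)))"

lemma word_mat_carrier: "word_mat w \<in> carrier_mat (Suc (length u)) (Suc (length u))"
  by (induction w) (auto simp: word_mat_def intro: mult_carrier_mat path_mat_carrier)

lemma word_mat_Nil: "word_mat [] = 1\<^sub>m (Suc (length u))"
  by (simp add: word_mat_def)

lemma word_mat_Cons:
  assumes "i \<le> length u" "j \<le> length u"
  shows "word_mat (b # w) $$ (i, j)
           = (\<Sum>l\<le>length u. path_mat u adj b $$ (i, l) * word_mat w $$ (l, j))"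
proof -
  have "word_mat (b # w) = path_mat u adj b * word_mat w"
    by (simp add: word_mat_def)
  then show ?thesis
    using assms path_mat_carrier[of u adj b] word_mat_carrier[of w]
    by (simp add: scalar_prod_def lessThan_Suc_atMost atLeast0LessThan)
qed

lemma word_mat_Cons_nonzero:
  assumes "i \<le> length u" "j \<le> length u" "word_mat (b # w) $$ (i, j) \<noteq> 0"
  obtains l where "l \<le> length u" "word_mat w $$ (l, j) \<noteq> 0"
    "l = Suc i \<and> u ! i = b \<or> i = Suc l \<and> u ! l = adj b"
proof -
  from assms(3) have "(\<Sum>l\<le>length u. path_mat u adj b $$ (i, l) * word_mat w $$ (l, j)) \<noteq> 0"
    unfolding word_mat_Cons[OF assms(1,2)] .
  then obtain l where "l \<le> length u" "path_mat u adj b $$ (i, l) * word_mat w $$ (l, j) \<noteq> 0"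
    by (elim sum.not_neutral_contains_not_neutral) simp
  with that assms(1) show thesis
    by (auto simp: path_mat_def split: if_splits)
qed

text \<open>Each step advances by at most one vertex.\<close>

lemma word_mat_nonzero_length:
  assumes "i \<le> length u" "word_mat w $$ (i, length u) \<noteq> 0"
  shows "length u \<le> i + length w"
  using assms
proof (induction w arbitrary: i)
  case Nil
  then show ?case by (simp add: word_mat_Nil split: if_splits)
next
  case (Cons b w)
  obtain l where l: "l \<le> length u" "word_mat w $$ (l, length u) \<noteq> 0"
    "l = Suc i \<and> u ! i = b \<or> i = Suc l \<and> u ! l = adj b"
    by (rule word_mat_Cons_nonzero[OF Cons.prems(1) le_refl Cons.prems(2)])
  from Cons.IH[OF l(1,2)] l(3) show ?case by auto
qed

text \<open>With no step to spare, every step goes forward, so the letters read are forced.\<close>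

lemma word_mat_straight:
  assumes "i + length w = length u"
  shows "word_mat w $$ (i, length u) = (if w = drop i u then 1 else 0)"
  using assms
proof (induction w arbitrary: i)
  case Nil
  then show ?case by (simp add: word_mat_Nil)
next
  case (Cons b w)
  have i: "i < length u" using Cons.prems by simp
  \<comment> \<open>After a first step that does not advance, too few letters remain to reach the
    end.\<close>
  have short: "word_mat w $$ (l, length u) = 0" if "l \<le> i" for l
  proof (rule ccontr)
    assume "word_mat w $$ (l, length u) \<noteq> 0"
    from word_mat_nonzero_length[OF _ this] show False
      using that i Cons.prems by simp
  qed
  have "path_mat u adj b $$ (i, l) * word_mat w $$ (l, length u)
      = (if l = Suc i then if u ! i = b then word_mat w $$ (Suc i, length u) else 0 else 0)"
    if "l \<le> length u" for l
    using that i short[of l] by (auto simp: path_mat_def)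
  then have "word_mat (b # w) $$ (i, length u)
      = (if u ! i = b then word_mat w $$ (Suc i, length u) else 0)"
    using i by (simp add: word_mat_Cons)
  also have "\<dots> = (if b # w = drop i u then 1 else 0)"
    using Cons.IH[of "Suc i"] Cons.prems by (auto simp: Cons_nth_drop_Suc[OF i, symmetric])
  finally show ?case .
qed

text \<open>
  A walk to the last vertex that starts at \<open>i\<close> and uses one of the first \<open>k\<close> edges has to get back
  from vertex \<open>k\<close> to the end, after having come down from \<open>i\<close> to \<open>k\<close> in case \<open>i > k\<close>.
\<close>

lemma word_mat_nonzero_detour:
  fixes dir :: "'b \<Rightarrow> bool"
  assumes dir_u: "\<And>i. i < length u \<Longrightarrow> dir (u ! i) \<longleftrightarrow> i < k"
    and dir_adj: "\<And>b. dir (adj b) = dir b"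
    and "i \<le> length u" "word_mat w $$ (i, length u) \<noteq> 0"
  defines "m \<equiv> length (filter (\<lambda>b. \<not> dir b) w)"
  shows "if \<exists>b\<in>set w. dir b then length u \<le> m + k \<and> length u + i \<le> m + 2 * k
         else length u \<le> m + i"
  unfolding m_def using assms(3,4)
proof (induction w arbitrary: i)
  case Nil
  then show ?case by (auto simp: word_mat_Nil split: if_splits)
next
  case (Cons b w)
  obtain l where l: "l \<le> length u" "word_mat w $$ (l, length u) \<noteq> 0"
    "l = Suc i \<and> u ! i = b \<or> i = Suc l \<and> u ! l = adj b"
    by (rule word_mat_Cons_nonzero[OF Cons.prems(1) le_refl Cons.prems(2)])
  \<comment> \<open>Vertex \<open>k\<close> separates the h-edges from the x-edges, so each step
    stays on one side of it.\<close>
  have "if dir b then i \<le> k \<and> l \<le> k else k \<le> i \<and> k \<le> l"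
    using l dir_u[of i] dir_u[of l] Cons.prems(1) dir_adj[of b] by auto
  with Cons.IH[OF l(1,2)] l(3) show ?case
    by (auto split: if_splits)
qed

end

lemma nc_eval_path:
  assumes "i \<le> length u" "j \<le> length u"
  shows "nc_eval (Suc (length u)) (path_mat u adj) q $$ (i, j)
    = (\<Sum>w\<in>Poly_Mapping.keys q. Poly_Mapping.lookup q w * word_mat u adj (letters w) $$ (i, j))"
  using assms by (simp add: nc_eval_def word_mat_def)

text \<open>Common core for both kinds of variables; positivity is tested on path matrices.\<close>

lemma (in shift_letters) degree_le_of_path_psd:
  fixes k :: nat and adj :: "'b \<Rightarrow> 'b" and p :: "'a nc_poly"
  defines "q \<equiv> nc_deriv0 k (\<lambda>t. nc_subst (\<lambda>a. nc_letter (f a) + nc_const t * nc_letter (g a)) p)"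
  assumes k: "k \<ge> 1" and dir_adj: "\<And>b. dir (adj b) = dir b"
    and psd: "\<And>u. psd_mat (Suc (length u)) (nc_eval (Suc (length u)) (path_mat u adj) q)"
  shows "nc_degree p \<le> k"
proof (rule ccontr)
  assume "\<not> nc_degree p \<le> k"
  then have kd: "k < nc_degree p" by simp
  then obtain a where a: "a \<in> Poly_Mapping.keys p" "length (letters a) = nc_degree p"
    by (elim nc_degree_attained[rotated]) simp
  define u where "u = map g (take k (letters a)) @ map f (drop k (letters a))"
  have len_u: "length u = nc_degree p" using a kd by (simp add: u_def)
  have base_u: "map base u = letters a" by (simp add: u_def comp_def)
  have dcount_u: "dcount u = k"
    using a kd by (simp add: dcount_def u_def filter_map comp_def)
  have dir_u: "dir (u ! i) \<longleftrightarrow> i < k" if "i < length u" for i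
  proof (cases "i < k")
    case True
    then have "u ! i = g (letters a ! i)" using kd a by (simp add: u_def nth_append)
    with True show ?thesis by simp
  next
    case False
    then have "u ! i = f (letters a ! i)" using that kd a len_u by (simp add: u_def nth_append)
    with False show ?thesis by simp
  qed
  have lookup_q: "Poly_Mapping.lookup q w = (if dcount (letters w) = k
        then fact k * Poly_Mapping.lookup p (NCWord (map base (letters w))) else 0)" for w
    unfolding q_def by (rule lookup_deriv_shift)
  have keys_q: "dcount (letters w) = k \<and> length (letters w) \<le> length u"
    if "w \<in> Poly_Mapping.keys q" for w
  proof -
    from that have "Poly_Mapping.lookup q w \<noteq> 0" by (simp add: in_keys_iff)
    then have "dcount (letters w) = k" "NCWord (map base (letters w)) \<in> Poly_Mapping.keys p"
      by (auto simp: lookup_q in_keys_iff split: if_splits)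
    with length_le_nc_degree[OF this(2)] len_u show ?thesis by simp
  qed
  let ?E = "nc_eval (Suc (length u)) (path_mat u adj) q"
  have "word_mat u adj (letters w) $$ (length u, length u) = 0" if "w \<in> Poly_Mapping.keys q" for w
  proof (rule ccontr)
    assume nz: "word_mat u adj (letters w) $$ (length u, length u) \<noteq> 0"
    \<comment> \<open>With \<open>d = length u\<close>, at most \<open>d - k\<close> letters are of
      type x, but a closed walk at \<open>d\<close> with an h-letter, present as
      \<open>k \<ge> 1\<close>, needs \<open>2 * (d - k)\<close>.\<close>
    have "dcount (letters w) + length (filter (\<lambda>b. \<not> dir b) (letters w)) = length (letters w)"
      unfolding dcount_def by (rule sum_length_filter_compl)
    moreover have "filter dir (letters w) \<noteq> []"
      using keys_q[OF that] k by (auto simp: dcount_def)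
    then have "\<exists>b\<in>set (letters w). dir b"
      by (simp add: filter_empty_conv)
    ultimately show False
      using word_mat_nonzero_detour[where dir = dir and k = k, OF dir_u dir_adj _ nz]
        keys_q[OF that] kd len_u
      by simp
  qed
  then have corner: "?E $$ (length u, length u) = 0"
    by (simp add: nc_eval_path)
  have "?E $$ (0, length u) = 0"
    by (rule psd_mat_zero_diag[OF psd _ _ corner]) simp_all
  moreover have "?E $$ (0, length u) = fact k * Poly_Mapping.lookup p a"
  proof -
    \<comment> \<open>Shorter words do not reach the end; those of full length must spell
      \<open>u\<close>.\<close>
    have "word_mat u adj (letters w) $$ (0, length u) = (if w = NCWord u then 1 else 0)"
      if "w \<in> Poly_Mapping.keys q" for w
    proof (cases "length (letters w) = length u")
      case True
      then show ?thesis using word_mat_straight[of 0 "letters w" u adj] by (cases w) auto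
    next
      case False
      then show ?thesis
        using keys_q[OF that] word_mat_nonzero_length[of 0 u adj "letters w"] by auto
    qed
    then have "?E $$ (0, length u) = (\<Sum>w\<in>Poly_Mapping.keys q.
        if w = NCWord u then Poly_Mapping.lookup q w else 0)"
      unfolding nc_eval_path[OF le0 le_refl] by (intro sum.cong) auto
    also have "\<dots> = Poly_Mapping.lookup q (NCWord u)"
      by (simp add: in_keys_iff)
    finally show ?thesis by (simp add: lookup_q base_u dcount_u)
  qed
  ultimately show False using a(1) by (simp add: in_keys_iff)
qed

section \<open>Symmetric and free variables\<close>

text \<open>With \<open>adj\<close> the identity, path matrices are symmetric, hence
  admissible.\<close>

lemma nc_degree_le_sym:
  assumes k: "k \<ge> 1" and pos: "sym_matrix_positive (sym_dirderiv k p)"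
  shows "nc_degree p \<le> k"
proof -
  interpret shift_letters Inl Inr "case_sum (\<lambda>j. j) (\<lambda>j. j)" "case_sum (\<lambda>_. False) (\<lambda>_. True)"
    by standard (auto split: sum.split)
  show ?thesis
  proof (rule degree_le_of_path_psd[where adj = "\<lambda>b. b", OF k])
    fix u :: "('a + 'a) list"
    let ?A = "path_mat u (\<lambda>b. b)"
    have trans: "transpose_mat (?A b) = ?A b" for b
      by (rule eq_matI) (auto simp: path_mat_def)
    have "psd_mat (Suc (length u)) (nc_eval (Suc (length u))
        (case_sum (\<lambda>j. ?A (Inl j)) (\<lambda>j. ?A (Inr j))) (sym_dirderiv k p))"
      by (rule pos[unfolded sym_matrix_positive_def, rule_format])
        (simp_all add: path_mat_carrier trans)
    moreover have "case_sum (\<lambda>j. ?A (Inl j)) (\<lambda>j. ?A (Inr j)) = ?A"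
      by (auto simp: fun_eq_iff split: sum.split)
    ultimately show "psd_mat (Suc (length u)) (nc_eval (Suc (length u)) ?A
        (nc_deriv0 k (\<lambda>t. nc_subst (\<lambda>a. nc_letter (Inl a) + nc_const t * nc_letter (Inr a)) p)))"
      by (simp add: sym_dirderiv_def sym_shift_def)
  qed simp
qed

lemma nc_degree_le_free:
  assumes k: "k \<ge> 1" and pos: "free_matrix_positive (free_dirderiv k p)"
  shows "nc_degree p \<le> k"
proof -
  let ?isr = "case_sum (\<lambda>_. False) (\<lambda>_. True) :: 'a + 'a \<Rightarrow> bool"
  let ?dir = "case_letter ?isr ?isr"
  interpret shift_letters "map_letter Inl" "map_letter Inr"
    "map_letter (case_sum (\<lambda>j. j) (\<lambda>j. j))" ?dir
  proof
    fix b :: "('a + 'a) letter"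
    let ?base = "map_letter (case_sum (\<lambda>j. j) (\<lambda>j. j)) :: _ \<Rightarrow> 'a letter"
    show "b = map_letter Inl (?base b) \<or> b = map_letter Inr (?base b)"
    proof (cases b)
      case (Var v)
      then show ?thesis by (cases v) simp_all
    next
      case (Adj v)
      then show ?thesis by (cases v) simp_all
    qed
  next
    fix a :: "'a letter"
    show "\<not> ?dir (map_letter Inl a)" "?dir (map_letter Inr a)" by (cases a; simp)+
  qed (simp_all add: letter.map_comp comp_def letter.map_ident)
  show ?thesis
  proof (rule degree_le_of_path_psd[where adj = letter_adj, OF k])
    fix u :: "('a + 'a) letter list"
    let ?A = "path_mat u letter_adj"
    have "psd_mat (Suc (length u)) (nc_eval (Suc (length u))
        (letter_value (case_sum (\<lambda>j. ?A (Var (Inl j))) (\<lambda>j. ?A (Var (Inr j)))))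
        (free_dirderiv k p))"
      by (rule pos[unfolded free_matrix_positive_def, rule_format])
        (simp_all add: path_mat_carrier)
    \<comment> \<open>The values of \<open>Var\<close> letters are chosen; transposition turns them
      into the path matrices of the \<open>Adj\<close> letters.\<close>
    moreover have "letter_value (case_sum (\<lambda>j. ?A (Var (Inl j))) (\<lambda>j. ?A (Var (Inr j)))) = ?A"
    proof
      fix l :: "('a + 'a) letter"
      have "transpose_mat (?A (Var v)) = ?A (Adj v)" for v
        by (rule eq_matI) (auto simp: path_mat_def)
      then show "letter_value (case_sum (\<lambda>j. ?A (Var (Inl j))) (\<lambda>j. ?A (Var (Inr j)))) l = ?A l"
        by (auto simp: letter_value_def split: letter.split sum.split)
    qed
    ultimately show "psd_mat (Suc (length u)) (nc_eval (Suc (length u)) ?A (nc_deriv0 k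
        (\<lambda>t. nc_subst (\<lambda>l. nc_letter (map_letter Inl l)
              + nc_const t * nc_letter (map_letter Inr l)) p)))"
      by (simp add: free_dirderiv_def free_shift_def)
  next
    fix b :: "('a + 'a) letter"
    show "?dir (letter_adj b) = ?dir b" by (cases b) auto
  qed
qed

theorem theorem9p4:
  fixes k :: nat
    and p :: "('g :: finite) nc_poly"
    and q :: "('g :: finite) letter nc_poly"
  assumes "k \<ge> 1"
  shows "(sym_star p = p \<and> sym_matrix_positive (sym_dirderiv k p) \<longrightarrow> nc_degree p \<le> k) \<and>
         (free_star q = q \<and> free_matrix_positive (free_dirderiv k q) \<longrightarrow> nc_degree q \<le> k)"
  using nc_degree_le_sym[OF assms] nc_degree_le_free[OF assms] by blast

end
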